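(* Let $a\ge 0$, $0<\mu<\tfrac12$, $c>0$, $T>0$, and let $e:[0,T]\to\mathbb{R}$ be continuous. Write $e_*=\min_{t\in[0,T]}e(t)$, $e^*=\max_{t\in[0,T]}e(t)$ and $e_+(t)=\max\{e(t),0\}$. Assume that there are $m>0$, $\kappa>0$ and $R_1,R_2>0$ with $R_1<R_2$ such that $$m<\sqrt{\left(\frac{\pi}{T}\right)^2+\left(\frac a2\right)^2}$$ and, with $G_m$ and $c_m$ the Green's function and the constant described in the context, (1) $e_*\le 0$ and $(c_mR_1)^{\mu}\ge\dfrac{c+\sqrt{c^2-4\mu m^2e_*}}{2\mu m^2}$; (2) $(c_mR_1)^{1-2\mu}\ge\kappa\mu$; (3) $\displaystyle\int_0^TG_m(\tau,\tau)\,e_+(\tau)\,d\tau\ge\frac{c_mR_1}{\kappa}$; (4) $e^*\le c\,R_2^{\mu}$. Then there exists a positive solution of the problem $$x''(t)+a\,x'(t)=\frac{e(t)}{\mu}\,x^{1-2\mu}(t)-\frac{c}{\mu}\,x^{1-\mu}(t),\quad t\in[0,T],\qquad x(0)=x(T),\quad x'(0)=x'(T).$$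
   Context: For $a\ge0$ and $0<m<\sqrt{(\pi/T)^2+(a/2)^2}$, $G_m:[0,T]\times[0,T]\to\mathbb{R}$ denotes the Green's function of the linear periodic problem $x''+a x'+m^2x=h(t)$ on $[0,T]$, $x(0)=x(T)$, $x'(0)=x'(T)$; i.e. for each continuous $h$ on $[0,T]$, the function $x(t)=\int_0^TG_m(t,\tau)h(\tau)\,d\tau$ is the unique solution of this problem. It is known that $G_m$ exists and is unique, that $G_m>0$ on $[0,T]\times[0,T]$, that $\int_0^TG_m(t,\tau)\,d\tau=1/m^2$ for all $t\in[0,T]$, and that there is a constant in $(0,1)$, fixed and denoted $c_m$, such that $G_m(t,\tau)\ge G_m(\tau,\tau)\ge c_m\,G_m(t,\tau)$ for all $(t,\tau)\in[0,T]\times[0,T]$. A positive solution is a solution $x$ with $x(t)>0$ for all $t\in[0,T]$. *)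

theory Defs
  imports "HOL-Analysis.Analysis"
begin

text \<open>A twice differentiable function on \<open>[0,T]\<close> (one-sided derivatives at the endpoints) with
  first and second derivatives \<open>x'\<close>, \<open>x''\<close>, such that \<open>x(0) = x(T)\<close> and \<open>x'(0) = x'(T)\<close>.
  In the equations below continuity of \<open>x''\<close> is automatic.\<close>

definition periodic_derivs ::
  "real \<Rightarrow> (real \<Rightarrow> real) \<Rightarrow> (real \<Rightarrow> real) \<Rightarrow> (real \<Rightarrow> real) \<Rightarrow> bool" where
  "periodic_derivs T x x' x'' \<longleftrightarrow>
     (\<forall>t\<in>{0..T}. (x has_real_derivative x' t) (at t within {0..T}) \<and>
                 (x' has_real_derivative x'' t) (at t within {0..T})) \<and>
     x 0 = x T \<and> x' 0 = x' T"

definition linear_periodic_solution ::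
  "real \<Rightarrow> real \<Rightarrow> real \<Rightarrow> (real \<Rightarrow> real) \<Rightarrow> (real \<Rightarrow> real) \<Rightarrow> bool" where
  "linear_periodic_solution T a m h x \<longleftrightarrow>
     (\<exists>x' x''. periodic_derivs T x x' x'' \<and>
        (\<forall>t\<in>{0..T}. x'' t + a * x' t + m\<^sup>2 * x t = h t))"

text \<open>Continuity on the square pins down the kernel pointwise. The integral property alone would
  leave its values on the diagonal undetermined.\<close>

definition periodic_green_function ::
  "real \<Rightarrow> real \<Rightarrow> real \<Rightarrow> (real \<Rightarrow> real \<Rightarrow> real) \<Rightarrow> bool" where
  "periodic_green_function T a m G \<longleftrightarrow>
     continuous_on ({0..T} \<times> {0..T}) (\<lambda>(t, \<tau>). G t \<tau>) \<and>
     (\<forall>h. continuous_on {0..T} h \<longrightarrow>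
        linear_periodic_solution T a m h (\<lambda>t. integral {0..T} (\<lambda>\<tau>. G t \<tau> * h \<tau>)) \<and>
        (\<forall>y. linear_periodic_solution T a m h y \<longrightarrow>
           (\<forall>t\<in>{0..T}. y t = integral {0..T} (\<lambda>\<tau>. G t \<tau> * h \<tau>))))"

definition positive_periodic_solution ::
  "real \<Rightarrow> real \<Rightarrow> real \<Rightarrow> real \<Rightarrow> (real \<Rightarrow> real) \<Rightarrow> (real \<Rightarrow> real) \<Rightarrow> bool" where
  "positive_periodic_solution T a \<mu> c e x \<longleftrightarrow>
     (\<forall>t\<in>{0..T}. x t > 0) \<and>
     (\<exists>x' x''. periodic_derivs T x x' x'' \<and>
        (\<forall>t\<in>{0..T}. x'' t + a * x' t =
           e t / \<mu> * x t powr (1 - 2 * \<mu>) - c / \<mu> * x t powr (1 - \<mu>)))"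

end

theory Submission
  imports Defs
begin

text \<open>
  Adding \<open>m\<^sup>2 x\<close> to both sides turns the problem into
  \<open>x'' + a x' + m\<^sup>2 x = F(t, x)\<close> with
  \<open>F(t, x) = x\<^bsup>1-2\<mu>\<^esup> (y (m\<^sup>2 y - c/\<mu>) + e(t)/\<mu>)\<close>, where \<open>y = x\<^bsup>\<mu>\<^esup>\<close>; equivalently into the
  fixed point equation \<open>x(t) = \<integral> G(t,\<tau>) F(\<tau>, x(\<tau>)) d\<tau>\<close>.

  The point is that the lower bound on \<open>(c\<^sub>m R\<^sub>1)\<^bsup>\<mu>\<^esup>\<close> makes the right-hand side not only nonnegative but increasing
  in \<open>x\<close> as soon as \<open>x \<ge> c\<^sub>m R\<^sub>1\<close>. It puts \<open>(c\<^sub>m R\<^sub>1)\<^bsup>\<mu>\<^esup>\<close> to the right of the larger root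
  of \<open>\<mu> m\<^sup>2 y\<^sup>2 - c y + e\<^sub>*\<close>, and there the bracket is a nonnegative increasing
  function of \<open>y\<close>, hence of \<open>x\<close>, and so is the other factor \<open>x\<^bsup>1-2\<mu>\<^esup>\<close>. Since \<open>G\<close> is
  nonnegative, the integral operator is order preserving on functions with values in
  \<open>[c\<^sub>m R\<^sub>1, R\<^sub>2]\<close>, and a fixed point exists once the two constants at the ends are moved
  towards each other.

  The constant \<open>c\<^sub>m R\<^sub>1\<close> is moved up, because \<open>F \<ge> e\<^sub>+ x\<^bsup>1-2\<mu>\<^esup> / \<mu>\<close> there, and the two
  conditions involving \<open>\<kappa>\<close> bound the resulting integral from below. The constant \<open>R\<^sub>2\<close> is moved down, because
  \<open>e\<^sup>* \<le> c R\<^sub>2\<^bsup>\<mu>\<^esup>\<close> gives \<open>F(t, R\<^sub>2) \<le> m\<^sup>2 R\<^sub>2\<close> and \<open>\<integral> G(t,\<tau>) d\<tau> = 1/m\<^sup>2\<close>. Iterating the operator from \<open>c\<^sub>m R\<^sub>1\<close> therefore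
  gives an increasing bounded sequence, whose pointwise limit is a fixed point by dominated
  convergence (\<open>monotone_integral_operator_fixed_point\<close>) and hence a solution
  (\<open>periodic_solution_between_constants\<close>).
\<close>

section \<open>Monotone iteration for an integral equation\<close>

lemma continuous_on_kernel_section:
  assumes "continuous_on (A \<times> B) (\<lambda>(t, s). K t s)" and "t \<in> A"
  shows "continuous_on B (K t)"
proof -
  have "continuous_on B (\<lambda>s. case (t, s) of (t, s) \<Rightarrow> K t s)"
    by (rule continuous_on_compose2[OF assms(1)]) (use assms(2) in \<open>auto intro!: continuous_intros\<close>)
  then show ?thesis by simp
qed

lemma continuous_on_substitution:
  assumes "continuous_on (A \<times> B) (\<lambda>(t, s). f t s)"
    and "continuous_on A x" and "\<And>t. t \<in> A \<Longrightarrow> x t \<in> B"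
  shows "continuous_on A (\<lambda>t. f t (x t))"
proof -
  have "continuous_on A (\<lambda>t. case (t, x t) of (t, s) \<Rightarrow> f t s)"
    by (rule continuous_on_compose2[OF assms(1)]) (use assms in \<open>auto intro!: continuous_intros\<close>)
  then show ?thesis by simp
qed

lemma continuous_on_compact_bound:
  fixes K :: "real \<Rightarrow> real \<Rightarrow> real"
  assumes "continuous_on (A \<times> B) (\<lambda>(t, s). K t s)" and "compact A" and "compact B"
  obtains M where "M \<ge> 0" and "\<And>t s. t \<in> A \<Longrightarrow> s \<in> B \<Longrightarrow> \<bar>K t s\<bar> \<le> M"
proof -
  have "bounded ((\<lambda>(t, s). K t s) ` (A \<times> B))"
    using assms by (intro compact_imp_bounded compact_continuous_image compact_Times)
  then obtain M where M: "M > 0" "\<forall>z \<in> (\<lambda>(t, s). K t s) ` (A \<times> B). norm z \<le> M"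
    by (auto simp: bounded_pos)
  show thesis
  proof (rule that)
    show "M \<ge> 0" using M(1) by simp
    show "\<bar>K t s\<bar> \<le> M" if "t \<in> A" "s \<in> B" for t s
      using bspec[OF M(2), of "K t s"] that by force
  qed
qed

text \<open>The order structure replaces compactness of the operator. The iterates increase and stay below
  \<open>\<beta>\<close>, so they converge pointwise, and the limit may be taken under the integral sign. The limit
  is continuous because it is the image of a bounded integrable function under a continuous kernel,
  which is a second use of dominated convergence.\<close>

lemma monotone_integral_operator_fixed_point:
  fixes K f :: "real \<Rightarrow> real \<Rightarrow> real" and p q \<alpha> \<beta> :: real
  assumes K: "continuous_on ({p..q} \<times> {p..q}) (\<lambda>(t, s). K t s)"
    and K_nonneg: "\<And>t s. t \<in> {p..q} \<Longrightarrow> s \<in> {p..q} \<Longrightarrow> K t s \<ge> 0"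
    and f: "continuous_on ({p..q} \<times> {\<alpha>..\<beta>}) (\<lambda>(s, u). f s u)"
    and f_mono: "\<And>s u v. s \<in> {p..q} \<Longrightarrow> \<alpha> \<le> u \<Longrightarrow> u \<le> v \<Longrightarrow> v \<le> \<beta> \<Longrightarrow> f s u \<le> f s v"
    and "\<alpha> \<le> \<beta>"
    and lower: "\<And>t. t \<in> {p..q} \<Longrightarrow> \<alpha> \<le> integral {p..q} (\<lambda>s. K t s * f s \<alpha>)"
    and upper: "\<And>t. t \<in> {p..q} \<Longrightarrow> integral {p..q} (\<lambda>s. K t s * f s \<beta>) \<le> \<beta>"
  obtains x where "continuous_on {p..q} x" and "\<And>t. t \<in> {p..q} \<Longrightarrow> x t \<in> {\<alpha>..\<beta>}"
    and "\<And>t. t \<in> {p..q} \<Longrightarrow> x t = integral {p..q} (\<lambda>s. K t s * f s (x s))"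
proof -
  define \<Phi> where "\<Phi> x t = integral {p..q} (\<lambda>s. K t s * f s (x s))" for x t
  define adm where "adm x \<longleftrightarrow> continuous_on {p..q} x \<and> (\<forall>t\<in>{p..q}. x t \<in> {\<alpha>..\<beta>})" for x
  have integrable: "(\<lambda>s. K t s * f s (x s)) integrable_on {p..q}" if "adm x" "t \<in> {p..q}" for x t
    using that unfolding adm_def
    by (intro integrable_continuous_interval continuous_on_mult
        continuous_on_kernel_section[OF K] continuous_on_substitution[OF f]) auto
  have \<Phi>_cont: "continuous_on {p..q} (\<Phi> x)" if "adm x" for x
  proof -
    have "continuous_on ({p..q} \<times> {p..q}) (\<lambda>z. f (snd z) (x (snd z)))"
      using that unfolding adm_def
      by (intro continuous_on_compose2[OF continuous_on_substitution[OF f, of x]])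
        (auto intro!: continuous_intros)
    with K have "continuous_on ({p..q} \<times> {p..q}) (\<lambda>(t, s). K t s * f s (x s))"
      unfolding case_prod_beta by (intro continuous_on_mult)
    then have "continuous_on {p..q} (\<lambda>t. integral (cbox p q) (\<lambda>s. K t s * f s (x s)))"
      by (intro integral_continuous_on_param) simp
    then show ?thesis by (simp add: \<Phi>_def[abs_def])
  qed
  have \<Phi>_mono: "\<Phi> x t \<le> \<Phi> y t"
    if "adm x" "adm y" "\<And>s. s \<in> {p..q} \<Longrightarrow> x s \<le> y s" "t \<in> {p..q}" for x y t
    unfolding \<Phi>_def using that
    by (intro integral_le integrable mult_left_mono f_mono K_nonneg) (auto simp: adm_def)
  have adm_const: "adm (\<lambda>_. \<alpha>)" "adm (\<lambda>_. \<beta>)"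
    using \<open>\<alpha> \<le> \<beta>\<close> by (auto simp: adm_def)
  have \<Phi>_adm: "adm (\<Phi> x)" if "adm x" for x
    unfolding adm_def
  proof (intro conjI ballI \<Phi>_cont[OF that])
    fix t assume t: "t \<in> {p..q}"
    have "\<alpha> \<le> \<Phi> (\<lambda>_. \<alpha>) t" using lower[OF t] by (simp add: \<Phi>_def)
    also have "\<dots> \<le> \<Phi> x t" using \<Phi>_mono[OF adm_const(1) that _ t] that by (auto simp: adm_def)
    finally have 1: "\<alpha> \<le> \<Phi> x t" .
    have "\<Phi> x t \<le> \<Phi> (\<lambda>_. \<beta>) t" using \<Phi>_mono[OF that adm_const(2) _ t] that by (auto simp: adm_def)
    also have "\<dots> \<le> \<beta>" using upper[OF t] by (simp add: \<Phi>_def)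
    finally show "\<Phi> x t \<in> {\<alpha>..\<beta>}" using 1 by simp
  qed
  define X where "X n = (\<Phi> ^^ n) (\<lambda>_. \<alpha>)" for n
  have X_Suc: "X (Suc n) = \<Phi> (X n)" for n by (simp add: X_def)
  have X_adm: "adm (X n)" for n
    by (induction n) (auto simp: X_Suc \<Phi>_adm, simp add: X_def adm_const)
  then have X_range: "X n t \<in> {\<alpha>..\<beta>}" if "t \<in> {p..q}" for n t
    using that by (auto simp: adm_def)
  have X_le: "X n t \<le> X (Suc n) t" if "t \<in> {p..q}" for n t
    using that
  proof (induction n arbitrary: t)
    case 0
    then show ?case using lower by (simp add: X_def \<Phi>_def)
  next
    case (Suc n)
    then show ?case by (simp only: X_Suc[of "Suc n"] X_Suc[of n]) (metis \<Phi>_mono X_Suc X_adm)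
  qed
  define x where "x t = lim (\<lambda>n. X n t)" for t
  have X_lim: "(\<lambda>n. X n t) \<longlonglongrightarrow> x t" if t: "t \<in> {p..q}" for t
  proof -
    have "incseq (\<lambda>n. X n t)" by (rule incseq_SucI) (rule X_le[OF t])
    then obtain L where "(\<lambda>n. X n t) \<longlonglongrightarrow> L"
      using incseq_convergent[of "\<lambda>n. X n t" \<beta>] X_range[OF t] by (metis atLeastAtMost_iff)
    then show ?thesis using limI x_def by metis
  qed
  have x_range: "x t \<in> {\<alpha>..\<beta>}" if "t \<in> {p..q}" for t
    by (rule Lim_in_closed_set[OF _ _ _ X_lim[OF that]]) (use X_range[OF that] in auto)
  obtain M where M: "M \<ge> 0" "\<And>t s. t \<in> {p..q} \<Longrightarrow> s \<in> {p..q} \<Longrightarrow> \<bar>K t s\<bar> \<le> M"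
    using continuous_on_compact_bound[OF K] by auto
  obtain N where N: "N \<ge> 0" "\<And>s u. s \<in> {p..q} \<Longrightarrow> u \<in> {\<alpha>..\<beta>} \<Longrightarrow> \<bar>f s u\<bar> \<le> N"
    using continuous_on_compact_bound[OF f] by auto
  have bound: "norm (K t s * f s u) \<le> M * N" if "t \<in> {p..q}" "s \<in> {p..q}" "u \<in> {\<alpha>..\<beta>}" for t s u
    using that M N by (auto simp: abs_mult intro!: mult_mono)
  have conv: "(\<lambda>s. K t s * f s (x s)) integrable_on {p..q} \<and> (\<lambda>n. \<Phi> (X n) t) \<longlonglongrightarrow> \<Phi> x t"
    if t: "t \<in> {p..q}" for t
    unfolding \<Phi>_def
    \<comment> \<open>integrability of the limit and convergence of the integrals are the two conclusions of the
      same theorem, hence the same premises twice\<close>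
  proof (intro conjI; rule dominated_convergence[where h = "\<lambda>_. M * N"])
    have lim: "(\<lambda>n. K t s * f s (X n s)) \<longlonglongrightarrow> K t s * f s (x s)" if s: "s \<in> {p..q}" for s
    proof (rule tendsto_mult_left)
      show "(\<lambda>n. f s (X n s)) \<longlonglongrightarrow> f s (x s)"
        using continuous_on_tendsto_compose[OF continuous_on_kernel_section[OF f s] X_lim[OF s]]
          x_range[OF s] X_range[OF s] by simp
    qed
    then show "\<And>s. s \<in> {p..q} \<Longrightarrow> (\<lambda>n. K t s * f s (X n s)) \<longlonglongrightarrow> K t s * f s (x s)"
      and "\<And>s. s \<in> {p..q} \<Longrightarrow> (\<lambda>n. K t s * f s (X n s)) \<longlonglongrightarrow> K t s * f s (x s)"
      by blast+
  qed (use t X_adm X_range bound integrable in auto)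
  have fix_eq: "x t = \<Phi> x t" if "t \<in> {p..q}" for t
  proof (rule LIMSEQ_unique)
    show "(\<lambda>n. X (Suc n) t) \<longlonglongrightarrow> x t" by (rule LIMSEQ_Suc[OF X_lim[OF that]])
    show "(\<lambda>n. X (Suc n) t) \<longlonglongrightarrow> \<Phi> x t" using conv[OF that] by (simp add: X_Suc)
  qed
  have "continuous_on {p..q} (\<Phi> x)"
    unfolding continuous_on_sequentially comp_def
  proof (intro allI ballI impI)
    fix u t assume t: "t \<in> {p..q}" and "(\<forall>n. u n \<in> {p..q}) \<and> u \<longlonglongrightarrow> t"
    then have u: "\<And>n. u n \<in> {p..q}" "u \<longlonglongrightarrow> t" by auto
    show "(\<lambda>n. \<Phi> x (u n)) \<longlonglongrightarrow> \<Phi> x t"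
      unfolding \<Phi>_def
    proof (rule dominated_convergence(2)[where h = "\<lambda>_. M * N"])
      show "(\<lambda>n. K (u n) s * f s (x s)) \<longlonglongrightarrow> K t s * f s (x s)" if s: "s \<in> {p..q}" for s
      proof (rule tendsto_mult_right)
        have "(\<lambda>n. (u n, s)) \<longlonglongrightarrow> (t, s)" by (intro tendsto_intros u)
        from continuous_on_tendsto_compose[OF K this] show "(\<lambda>n. K (u n) s) \<longlonglongrightarrow> K t s"
          using t s u by simp
      qed
    qed (use u conv bound x_range in auto)
  qed
  then have x_cont: "continuous_on {p..q} x"
    using continuous_on_cong[of "{p..q}" "{p..q}" x "\<Phi> x"] fix_eq by auto
  show thesis
    using that[of x] x_cont x_range fix_eq by (auto simp: \<Phi>_def)
qed

section \<open>Periodic problems with a nonnegative Green function\<close>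

lemma green_function_continuous:
  assumes "periodic_green_function T a m G"
  shows "continuous_on ({0..T} \<times> {0..T}) (\<lambda>(t, \<tau>). G t \<tau>)"
  using assms by (simp add: periodic_green_function_def)

text \<open>The constant \<open>1/m\<^sup>2\<close> solves the linear problem with right-hand side \<open>1\<close>, so uniqueness
  identifies it with the integral of the kernel.\<close>

lemma integral_green_function:
  assumes "periodic_green_function T a m G" and "m \<noteq> 0" and "t \<in> {0..T}"
  shows "integral {0..T} (G t) = 1 / m\<^sup>2"
proof -
  have "linear_periodic_solution T a m (\<lambda>_. 1) (\<lambda>_. 1 / m\<^sup>2)"
    unfolding linear_periodic_solution_def periodic_derivs_def
    by (rule exI[of _ "\<lambda>_. 0"], rule exI[of _ "\<lambda>_. 0"]) (use assms(2) in auto)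
  moreover have "continuous_on {0..T} (\<lambda>_. 1 :: real)" by simp
  ultimately have "1 / m\<^sup>2 = integral {0..T} (\<lambda>\<tau>. G t \<tau> * 1)"
    using assms(1,3) unfolding periodic_green_function_def by blast
  then show ?thesis by simp
qed

text \<open>The two-sided comparison with the diagonal already forces the sign: it gives
  \<open>G(\<tau>,\<tau>) \<ge> c\<^sub>m G(\<tau>,\<tau>)\<close> with \<open>c\<^sub>m < 1\<close>.\<close>

lemma kernel_nonneg_if_diagonal_comparison:
  fixes G :: "real \<Rightarrow> real \<Rightarrow> real"
  assumes "cm < 1"
    and "\<And>t \<tau>. t \<in> A \<Longrightarrow> \<tau> \<in> A \<Longrightarrow> G t \<tau> \<ge> G \<tau> \<tau> \<and> G \<tau> \<tau> \<ge> cm * G t \<tau>"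
    and "t \<in> A" and "\<tau> \<in> A"
  shows "G \<tau> \<tau> \<ge> 0" and "G t \<tau> \<ge> 0"
proof -
  have "(1 - cm) * G \<tau> \<tau> \<ge> 0"
    using assms(2)[OF assms(4,4)] by (simp add: algebra_simps)
  then show "G \<tau> \<tau> \<ge> 0" using assms(1) by (simp add: zero_le_mult_iff)
  then show "G t \<tau> \<ge> 0" using assms(2)[OF assms(3,4)] by linarith
qed

text \<open>The fixed point is continuous, so \<open>t \<mapsto> f(t, x(t))\<close> is an admissible right-hand side of the
  linear problem, and the defining property of \<open>G\<close> supplies the two derivatives and the periodicity.\<close>

lemma periodic_solution_between_constants:
  fixes f :: "real \<Rightarrow> real \<Rightarrow> real"
  assumes green: "periodic_green_function T a m G"
    and G_nonneg: "\<And>t s. t \<in> {0..T} \<Longrightarrow> s \<in> {0..T} \<Longrightarrow> G t s \<ge> 0"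
    and f: "continuous_on ({0..T} \<times> {\<alpha>..\<beta>}) (\<lambda>(s, u). f s u)"
    and f_mono: "\<And>s u v. s \<in> {0..T} \<Longrightarrow> \<alpha> \<le> u \<Longrightarrow> u \<le> v \<Longrightarrow> v \<le> \<beta> \<Longrightarrow> f s u \<le> f s v"
    and "\<alpha> \<le> \<beta>"
    and lower: "\<And>t. t \<in> {0..T} \<Longrightarrow> \<alpha> \<le> integral {0..T} (\<lambda>s. G t s * f s \<alpha>)"
    and upper: "\<And>t. t \<in> {0..T} \<Longrightarrow> integral {0..T} (\<lambda>s. G t s * f s \<beta>) \<le> \<beta>"
  obtains x x' x'' where "\<And>t. t \<in> {0..T} \<Longrightarrow> x t \<in> {\<alpha>..\<beta>}" and "periodic_derivs T x x' x''"
    and "\<And>t. t \<in> {0..T} \<Longrightarrow> x'' t + a * x' t + m\<^sup>2 * x t = f t (x t)"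
proof -
  obtain y where y: "continuous_on {0..T} y" "\<And>t. t \<in> {0..T} \<Longrightarrow> y t \<in> {\<alpha>..\<beta>}"
      "\<And>t. t \<in> {0..T} \<Longrightarrow> y t = integral {0..T} (\<lambda>s. G t s * f s (y s))"
    by (rule monotone_integral_operator_fixed_point[OF green_function_continuous[OF green]
        G_nonneg f f_mono \<open>\<alpha> \<le> \<beta>\<close> lower upper]) blast+
  define x where "x t = integral {0..T} (\<lambda>s. G t s * f s (y s))" for t
  have xy: "x t = y t" if "t \<in> {0..T}" for t using y(3)[OF that] by (simp add: x_def)
  have "continuous_on {0..T} (\<lambda>t. f t (y t))"
    using continuous_on_substitution[OF f y(1,2)] .
  then have "linear_periodic_solution T a m (\<lambda>t. f t (y t)) x"
    using green unfolding periodic_green_function_def x_def[abs_def] by blast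
  then show thesis
    unfolding linear_periodic_solution_def using that[of x] xy y(2) by auto
qed

section \<open>The nonlinearity to the right of the larger root\<close>

text \<open>The factored form of \<open>m\<^sup>2 u + (s/\<mu>) u\<^bsup>1-2\<mu>\<^esup> - (c/\<mu>) u\<^bsup>1-\<mu>\<^esup>\<close>, here with \<open>s\<close>
  for the value of \<open>e\<close>. When \<open>s \<ge> e\<^sub>*\<close> and \<open>u\<^bsup>\<mu>\<^esup>\<close> is to the right of the larger root, both factors and
  the difference \<open>m\<^sup>2 u\<^bsup>\<mu>\<^esup> - c/\<mu>\<close> are nonnegative and increasing in \<open>u\<close>.\<close>

definition shifted_rhs :: "real \<Rightarrow> real \<Rightarrow> real \<Rightarrow> real \<Rightarrow> real \<Rightarrow> real" where
  "shifted_rhs m \<mu> c s u =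
     u powr (1 - 2 * \<mu>) * (u powr \<mu> * (m\<^sup>2 * u powr \<mu> - c / \<mu>) + s / \<mu>)"

lemma shifted_rhs_expand:
  assumes "u > 0"
  shows "shifted_rhs m \<mu> c s u =
    m\<^sup>2 * u + (s / \<mu> * u powr (1 - 2 * \<mu>) - c / \<mu> * u powr (1 - \<mu>))"
proof -
  have "u powr (1 - 2 * \<mu>) * u powr \<mu> = u powr (1 - \<mu>)"
    by (simp add: powr_add[symmetric])
  moreover have "u powr (1 - \<mu>) * u powr \<mu> = u"
    using assms by (simp add: powr_add[symmetric])
  ultimately show ?thesis
    unfolding shifted_rhs_def by (simp add: algebra_simps)
qed

text \<open>A point to the right of the larger root of \<open>\<mu> m\<^sup>2 y\<^sup>2 - c y + s\<close>
  is in particular, since \<open>s \<le> 0\<close>, to the right of the larger root \<open>c/(\<mu> m\<^sup>2)\<close> of \<open>\<mu> m\<^sup>2 y\<^sup>2 - c y\<close>.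
  The sign of the linear factor makes the product \<open>y (m\<^sup>2 y - c/\<mu>)\<close> increasing in \<open>y\<close>; the sign of
  the whole quadratic allows it to be multiplied by a second increasing factor.\<close>

lemma right_of_larger_root:
  fixes \<mu> m c s y :: real
  assumes "\<mu> > 0" "m > 0" "c > 0" "s \<le> 0"
    and y: "y \<ge> (c + sqrt (c\<^sup>2 - 4 * \<mu> * m\<^sup>2 * s)) / (2 * \<mu> * m\<^sup>2)"
  shows "m\<^sup>2 * y - c / \<mu> \<ge> 0" and "y * (m\<^sup>2 * y - c / \<mu>) + s / \<mu> \<ge> 0"
proof -
  define d where "d = sqrt (c\<^sup>2 - 4 * \<mu> * m\<^sup>2 * s)"
  have "4 * \<mu> * m\<^sup>2 * s \<le> 0"
    using assms by (intro mult_nonneg_nonpos) auto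
  then have nonpos: "c\<^sup>2 \<le> c\<^sup>2 - 4 * \<mu> * m\<^sup>2 * s" by linarith
  have d2: "d\<^sup>2 = c\<^sup>2 - 4 * \<mu> * m\<^sup>2 * s"
    unfolding d_def using nonpos zero_le_power2[of c] by (intro real_sqrt_pow2) linarith
  have dc: "d \<ge> c"
    unfolding d_def by (rule real_le_rsqrt[OF nonpos])
  have "c + d \<le> 2 * \<mu> * m\<^sup>2 * y"
    using y assms(1,2) by (simp add: d_def pos_divide_le_eq mult_ac)
  then have *: "d \<le> 2 * \<mu> * m\<^sup>2 * y - c" by simp
  with dc have "c \<le> \<mu> * (m\<^sup>2 * y)" by simp
  then show "m\<^sup>2 * y - c / \<mu> \<ge> 0"
    using assms(1) by (simp add: pos_divide_le_eq mult.commute)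
  \<comment> \<open>completing the square\<close>
  have "d\<^sup>2 \<le> (2 * \<mu> * m\<^sup>2 * y - c)\<^sup>2"
    using * dc assms(3) by (intro power_mono) auto
  also have "(2 * \<mu> * m\<^sup>2 * y - c)\<^sup>2 =
      c\<^sup>2 - 4 * \<mu> * m\<^sup>2 * s + (4 * \<mu>\<^sup>2 * m\<^sup>2) * (y * (m\<^sup>2 * y - c / \<mu>) + s / \<mu>)"
    using assms(1) by (simp add: field_simps power2_eq_square)
  finally have "0 \<le> (4 * \<mu>\<^sup>2 * m\<^sup>2) * (y * (m\<^sup>2 * y - c / \<mu>) + s / \<mu>)"
    unfolding d2 by simp
  moreover have "4 * \<mu>\<^sup>2 * m\<^sup>2 > 0" using assms(1,2) by simp
  ultimately show "y * (m\<^sup>2 * y - c / \<mu>) + s / \<mu> \<ge> 0"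
    by (meson mult_pos_neg not_le)
qed

lemma shifted_rhs_mono:
  fixes \<mu> m c s0 s u v :: real
  assumes "\<mu> > 0" "\<mu> < 1 / 2" "s0 \<le> s" "0 < u" "u \<le> v"
    and slope: "m\<^sup>2 * u powr \<mu> - c / \<mu> \<ge> 0"
    and nonneg: "u powr \<mu> * (m\<^sup>2 * u powr \<mu> - c / \<mu>) + s0 / \<mu> \<ge> 0"
  shows "shifted_rhs m \<mu> c s u \<le> shifted_rhs m \<mu> c s v"
proof -
  have le: "u powr \<mu> \<le> v powr \<mu>" "u powr (1 - 2 * \<mu>) \<le> v powr (1 - 2 * \<mu>)"
    using assms by (auto intro!: powr_mono2)
  have "u powr \<mu> * (m\<^sup>2 * u powr \<mu> - c / \<mu>) \<le> v powr \<mu> * (m\<^sup>2 * v powr \<mu> - c / \<mu>)"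
    using le(1) slope by (intro mult_mono diff_right_mono mult_left_mono) auto
  moreover have "s0 / \<mu> \<le> s / \<mu>" using assms by (simp add: divide_right_mono)
  ultimately show ?thesis
    unfolding shifted_rhs_def using le(2) nonneg by (intro mult_mono) auto
qed

lemma shifted_rhs_ge_positive_part:
  fixes \<mu> m c s0 s u :: real
  assumes "\<mu> > 0" "s0 \<le> s"
    and slope: "m\<^sup>2 * u powr \<mu> - c / \<mu> \<ge> 0"
    and nonneg: "u powr \<mu> * (m\<^sup>2 * u powr \<mu> - c / \<mu>) + s0 / \<mu> \<ge> 0"
  shows "u powr (1 - 2 * \<mu>) * (max s 0 / \<mu>) \<le> shifted_rhs m \<mu> c s u"
proof -
  have "s0 / \<mu> \<le> s / \<mu>" using assms by (simp add: divide_right_mono)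
  moreover have "u powr \<mu> * (m\<^sup>2 * u powr \<mu> - c / \<mu>) \<ge> 0" using slope by simp
  ultimately have "max s 0 / \<mu> \<le> u powr \<mu> * (m\<^sup>2 * u powr \<mu> - c / \<mu>) + s / \<mu>"
    using nonneg by (simp add: max_def)
  then show ?thesis unfolding shifted_rhs_def by (intro mult_left_mono) auto
qed

lemma shifted_rhs_le_linear:
  assumes "\<mu> > 0" "u > 0" "s \<le> c * u powr \<mu>"
  shows "shifted_rhs m \<mu> c s u \<le> m\<^sup>2 * u"
proof -
  have "s / \<mu> * u powr (1 - 2 * \<mu>) \<le> c * u powr \<mu> / \<mu> * u powr (1 - 2 * \<mu>)"
    using assms by (intro mult_right_mono divide_right_mono) auto
  also have "\<dots> = c / \<mu> * (u powr \<mu> * u powr (1 - 2 * \<mu>))" by simp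
  also have "u powr \<mu> * u powr (1 - 2 * \<mu>) = u powr (1 - \<mu>)"
    by (simp add: powr_add[symmetric])
  finally show ?thesis using shifted_rhs_expand[OF assms(2)] by simp
qed

lemma shifted_rhs_continuous:
  fixes e :: "real \<Rightarrow> real"
  assumes "continuous_on A e" and "\<mu> \<noteq> 0" and "\<And>u. u \<in> B \<Longrightarrow> u > 0"
  shows "continuous_on (A \<times> B) (\<lambda>(t, u). shifted_rhs m \<mu> c (e t) u)"
proof -
  have "continuous_on (A \<times> B) (\<lambda>z. e (fst z))"
    by (rule continuous_on_compose2[OF assms(1)]) (auto intro!: continuous_intros)
  moreover have "snd z \<noteq> 0" if "z \<in> A \<times> B" for z :: "real \<times> real" using assms(3) that by force
  ultimately show ?thesis
    unfolding shifted_rhs_def case_prod_beta using assms(2)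
    by (intro continuous_intros) auto
qed

section \<open>The existence theorem\<close>

theorem theorem11:
  fixes a \<mu> c T m \<kappa> R1 R2 cm :: real
    and e :: "real \<Rightarrow> real" and G :: "real \<Rightarrow> real \<Rightarrow> real"
  assumes "a \<ge> 0" and "0 < \<mu>" and "\<mu> < 1 / 2" and "c > 0" and "T > 0"
    and "continuous_on {0..T} e"
    and "m > 0" and "\<kappa> > 0" and "R1 > 0" and "R2 > 0" and "R1 < R2"
    and "m < sqrt ((pi / T)\<^sup>2 + (a / 2)\<^sup>2)"
    and "periodic_green_function T a m G"
    and "0 < cm" and "cm < 1"
    and "\<And>t \<tau>. t \<in> {0..T} \<Longrightarrow> \<tau> \<in> {0..T} \<Longrightarrow>
           G t \<tau> \<ge> G \<tau> \<tau> \<and> G \<tau> \<tau> \<ge> cm * G t \<tau>"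
    and "(INF t\<in>{0..T}. e t) \<le> 0"
    and "(cm * R1) powr \<mu> \<ge>
           (c + sqrt (c\<^sup>2 - 4 * \<mu> * m\<^sup>2 * (INF t\<in>{0..T}. e t))) / (2 * \<mu> * m\<^sup>2)"
    and "(cm * R1) powr (1 - 2 * \<mu>) \<ge> \<kappa> * \<mu>"
    and "integral {0..T} (\<lambda>\<tau>. G \<tau> \<tau> * max (e \<tau>) 0) \<ge> cm * R1 / \<kappa>"
    and "(SUP t\<in>{0..T}. e t) \<le> c * R2 powr \<mu>"
  shows "\<exists>x. positive_periodic_solution T a \<mu> c e x"
proof -
  note \<mu> = \<open>0 < \<mu>\<close> and green = \<open>periodic_green_function T a m G\<close>
    and e_cont = \<open>continuous_on {0..T} e\<close>
  define e0 where "e0 = (INF t\<in>{0..T}. e t)"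
  define \<alpha> where "\<alpha> = cm * R1"
  define F where "F t u = shifted_rhs m \<mu> c (e t) u" for t u
  have e_bounded: "bounded (e ` {0..T})"
    by (intro compact_imp_bounded compact_continuous_image e_cont) simp
  have e_lower: "e0 \<le> e t" if "t \<in> {0..T}" for t
    unfolding e0_def using that e_bounded by (intro cINF_lower bounded_imp_bdd_below)
  have e_upper: "e t \<le> c * R2 powr \<mu>" if "t \<in> {0..T}" for t
    using cSUP_upper[OF that bounded_imp_bdd_above[OF e_bounded]] assms(21) by linarith
  have \<alpha>_pos: "\<alpha> > 0" using assms by (simp add: \<alpha>_def)
  have "cm * R1 \<le> 1 * R1" using assms by (intro mult_right_mono) auto
  then have \<alpha>_le: "\<alpha> \<le> R2" using \<open>R1 < R2\<close> by (simp add: \<alpha>_def)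
  have \<alpha>_root: "\<alpha> powr \<mu> \<ge> (c + sqrt (c\<^sup>2 - 4 * \<mu> * m\<^sup>2 * e0)) / (2 * \<mu> * m\<^sup>2)"
    and "e0 \<le> 0"
    using assms by (auto simp: \<alpha>_def e0_def)
  have root: "m\<^sup>2 * u powr \<mu> - c / \<mu> \<ge> 0"
      "u powr \<mu> * (m\<^sup>2 * u powr \<mu> - c / \<mu>) + e0 / \<mu> \<ge> 0" if "\<alpha> \<le> u" for u
  proof -
    have "\<alpha> powr \<mu> \<le> u powr \<mu>" using that \<alpha>_pos \<mu> by (intro powr_mono2) auto
    with \<alpha>_root have "u powr \<mu> \<ge> (c + sqrt (c\<^sup>2 - 4 * \<mu> * m\<^sup>2 * e0)) / (2 * \<mu> * m\<^sup>2)" by linarith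
    from right_of_larger_root[OF \<mu> \<open>m > 0\<close> \<open>c > 0\<close> \<open>e0 \<le> 0\<close> this]
    show "m\<^sup>2 * u powr \<mu> - c / \<mu> \<ge> 0"
      "u powr \<mu> * (m\<^sup>2 * u powr \<mu> - c / \<mu>) + e0 / \<mu> \<ge> 0" by auto
  qed
  have G_nonneg: "G \<tau> \<tau> \<ge> 0" "G t \<tau> \<ge> 0" if "t \<in> {0..T}" "\<tau> \<in> {0..T}" for t \<tau>
    using kernel_nonneg_if_diagonal_comparison[OF \<open>cm < 1\<close> assms(16) that] by auto
  have G_cont: "continuous_on {0..T} (G t)" if "t \<in> {0..T}" for t
    using continuous_on_kernel_section[OF green_function_continuous[OF green] that] .
  have G_diag_cont: "continuous_on {0..T} (\<lambda>\<tau>. G \<tau> \<tau>)"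
    using continuous_on_substitution[OF green_function_continuous[OF green] continuous_on_id]
    by simp
  have F_cont: "continuous_on ({0..T} \<times> {\<alpha>..R2}) (\<lambda>(t, u). F t u)"
    unfolding F_def using \<alpha>_pos \<mu> by (intro shifted_rhs_continuous e_cont) auto
  have F_cont_const: "continuous_on {0..T} (\<lambda>t. F t u)" if "u \<in> {\<alpha>..R2}" for u
    using continuous_on_substitution[OF F_cont continuous_on_const] that .
  have lower: "\<alpha> \<le> integral {0..T} (\<lambda>\<tau>. G t \<tau> * F \<tau> \<alpha>)" if t: "t \<in> {0..T}" for t
  proof -
    let ?I = "\<lambda>\<tau>. G \<tau> \<tau> * max (e \<tau>) 0"
    have "\<kappa> \<le> \<alpha> powr (1 - 2 * \<mu>) / \<mu>"
      using assms(19) \<mu> by (simp add: \<alpha>_def pos_le_divide_eq)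
    then have pointwise: "\<kappa> * ?I \<tau> \<le> G t \<tau> * F \<tau> \<alpha>" if \<tau>: "\<tau> \<in> {0..T}" for \<tau>
    proof -
      have "\<kappa> * ?I \<tau> \<le> \<alpha> powr (1 - 2 * \<mu>) / \<mu> * ?I \<tau>"
        using \<open>\<kappa> \<le> \<alpha> powr (1 - 2 * \<mu>) / \<mu>\<close> G_nonneg(1)[OF t \<tau>] by (intro mult_right_mono) auto
      also have "\<dots> = G \<tau> \<tau> * (\<alpha> powr (1 - 2 * \<mu>) * (max (e \<tau>) 0 / \<mu>))" by simp
      also have "\<dots> \<le> G t \<tau> * F \<tau> \<alpha>"
        unfolding F_def using assms(16)[OF t \<tau>] G_nonneg(2)[OF t \<tau>] \<mu>
        by (intro mult_mono shifted_rhs_ge_positive_part[OF \<mu> e_lower[OF \<tau>] root]) auto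
      finally show ?thesis .
    qed
    have "\<alpha> \<le> \<kappa> * integral {0..T} ?I"
      using assms(20) \<open>\<kappa> > 0\<close> by (simp add: \<alpha>_def pos_divide_le_eq mult.commute)
    also have "\<dots> = integral {0..T} (\<lambda>\<tau>. \<kappa> * ?I \<tau>)" by simp
    also have "\<dots> \<le> integral {0..T} (\<lambda>\<tau>. G t \<tau> * F \<tau> \<alpha>)"
      using \<alpha>_le t pointwise
      by (intro integral_le integrable_continuous_interval continuous_intros
          G_cont G_diag_cont F_cont_const e_cont) auto
    finally show ?thesis .
  qed
  have upper: "integral {0..T} (\<lambda>\<tau>. G t \<tau> * F \<tau> R2) \<le> R2" if t: "t \<in> {0..T}" for t
  proof -
    have "integral {0..T} (\<lambda>\<tau>. G t \<tau> * F \<tau> R2) \<le> integral {0..T} (\<lambda>\<tau>. G t \<tau> * (m\<^sup>2 * R2))"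
      using \<alpha>_le t G_nonneg(2) shifted_rhs_le_linear[OF \<mu> \<open>R2 > 0\<close> e_upper]
      by (intro integral_le integrable_continuous_interval continuous_intros
          G_cont F_cont_const mult_left_mono) (auto simp: F_def)
    also have "\<dots> = R2"
      using integral_green_function[OF green _ t] \<open>m > 0\<close> by simp
    finally show ?thesis .
  qed
  have F_mono: "F s u \<le> F s v" if "s \<in> {0..T}" "\<alpha> \<le> u" "u \<le> v" "v \<le> R2" for s u v
    unfolding F_def using that \<alpha>_pos
    by (intro shifted_rhs_mono[OF \<mu> \<open>\<mu> < 1 / 2\<close> e_lower _ _ root]) auto
  obtain x x' x'' where x: "\<And>t. t \<in> {0..T} \<Longrightarrow> x t \<in> {\<alpha>..R2}" "periodic_derivs T x x' x''"
      "\<And>t. t \<in> {0..T} \<Longrightarrow> x'' t + a * x' t + m\<^sup>2 * x t = F t (x t)"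
    by (rule periodic_solution_between_constants[OF green G_nonneg(2) F_cont F_mono \<alpha>_le lower upper]) blast+
  have pos: "x t > 0" if "t \<in> {0..T}" for t using x(1)[OF that] \<alpha>_pos by simp
  have "x'' t + a * x' t = e t / \<mu> * x t powr (1 - 2 * \<mu>) - c / \<mu> * x t powr (1 - \<mu>)"
    if "t \<in> {0..T}" for t
    using x(3)[OF that] shifted_rhs_expand[OF pos[OF that], of m \<mu> c "e t"] by (simp add: F_def)
  then show ?thesis
    unfolding positive_periodic_solution_def using x(2) pos by blast
qed

end
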